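(* For quivers $Q,R$ define the quiver $R^Q$ by $\overrightarrow{V}(R^Q)=\mathbf{Set}(\overrightarrow{V}(Q),\overrightarrow{V}(R))$, $\overrightarrow{E}(R^Q)=\mathfrak{R}(\Upsilon(Q),\Upsilon(R))$, $\sigma_{R^Q}(\phi)=\check V(\phi)$, $\tau_{R^Q}(\phi)=\check E(\phi)$, and define the quiver morphism $\varepsilon^Q_R:Q\times R^Q\to R$ by $\overrightarrow{V}(\varepsilon^Q_R)(v,f)=f(v)$ and $\overrightarrow{E}(\varepsilon^Q_R)(e,\phi)=I(\phi)(e)$. Then for every quiver $K$ and every morphism $\psi:Q\times K\to R$ in $\mathfrak{Q}$ there is a unique morphism $\hat\psi:K\to R^Q$ in $\mathfrak{Q}$ such that $\varepsilon^Q_R\circ(Q\times\hat\psi)=\psi$.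
   Context: A quiver $Q$ consists of sets $\overrightarrow{V}(Q)$, $\overrightarrow{E}(Q)$ and functions $\sigma_Q,\tau_Q:\overrightarrow{E}(Q)\to\overrightarrow{V}(Q)$; morphisms are pairs of functions commuting with $\sigma,\tau$; category $\mathfrak{Q}$. The product $Q\times K$ in $\mathfrak{Q}$ has vertices $\overrightarrow{V}(Q)\times\overrightarrow{V}(K)$, edges $\overrightarrow{E}(Q)\times\overrightarrow{E}(K)$, source $\sigma_Q\times\sigma_K$, target $\tau_Q\times\tau_K$. An incidence hypergraph $G$ consists of sets $\check V(G)$, $\check E(G)$, $I(G)$ and functions $\varsigma_G:I(G)\to\check V(G)$, $\omega_G:I(G)\to\check E(G)$; a morphism is a triple $(\check V(\phi),\check E(\phi),I(\phi))$ with $\varsigma_H\circ I(\phi)=\check V(\phi)\circ\varsigma_G$ and $\omega_H\circ I(\phi)=\check E(\phi)\circ\omega_G$; category $\mathfrak{R}$ with hom-sets $\mathfrak{R}(G,H)$. $\Upsilon(Q)$ is the incidence hypergraph with $\check V=\check E=\overrightarrow{V}(Q)$, $I=\overrightarrow{E}(Q)$, $\varsigma=\sigma_Q$, $\omega=\tau_Q$. *)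

theory Defs
  imports "Graph_Theory.Digraph" "HOL-Library.FuncSet"
begin

text \<open>
  A quiver is a \<^locale>\<open>wf_digraph\<close>: the vertex and edge sets may be empty or infinite, and loops
  and parallel edges are allowed; \<open>tail\<close> is the source map and \<open>head\<close> the target map.

  A function between carrier sets is an element of \<open>A \<rightarrow>\<^sub>E B\<close>, that is, it takes the value
  \<open>undefined\<close> outside \<open>A\<close>. Equality of morphisms is therefore plain equality, and
  \<open>verts Q \<rightarrow>\<^sub>E verts R\<close> is the hom-set of \<open>Set\<close>.
\<close>

record ('v, 'e, 'w, 'f) quiver_map =
  vmap :: "'v \<Rightarrow> 'w"
  emap :: "'e \<Rightarrow> 'f"

definition quiver_hom ::
    "('v, 'e) pre_digraph \<Rightarrow> ('w, 'f) pre_digraph \<Rightarrow> ('v, 'e, 'w, 'f) quiver_map set" where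
  "quiver_hom Q R = {\<phi>.
     vmap \<phi> \<in> verts Q \<rightarrow>\<^sub>E verts R \<and> emap \<phi> \<in> arcs Q \<rightarrow>\<^sub>E arcs R \<and>
     (\<forall>e \<in> arcs Q. tail R (emap \<phi> e) = vmap \<phi> (tail Q e)) \<and>
     (\<forall>e \<in> arcs Q. head R (emap \<phi> e) = vmap \<phi> (head Q e))}"

definition quiver_id :: "('v, 'e) pre_digraph \<Rightarrow> ('v, 'e, 'v, 'e) quiver_map" where
  "quiver_id Q = \<lparr>vmap = restrict id (verts Q), emap = restrict id (arcs Q)\<rparr>"

text \<open>The argument \<open>P\<close> is the domain of \<open>\<phi>\<close>, as in \<^const>\<open>compose\<close>.\<close>

definition quiver_comp ::
    "('u, 'd) pre_digraph \<Rightarrow> ('v, 'e, 'w, 'f) quiver_map \<Rightarrow> ('u, 'd, 'v, 'e) quiver_map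
      \<Rightarrow> ('u, 'd, 'w, 'f) quiver_map" where
  "quiver_comp P \<psi> \<phi> =
     \<lparr>vmap = compose (verts P) (vmap \<psi>) (vmap \<phi>), emap = compose (arcs P) (emap \<psi>) (emap \<phi>)\<rparr>"

definition quiver_prod ::
    "('v, 'e) pre_digraph \<Rightarrow> ('w, 'f) pre_digraph \<Rightarrow> ('v \<times> 'w, 'e \<times> 'f) pre_digraph" where
  "quiver_prod Q K =
     \<lparr>verts = verts Q \<times> verts K, arcs = arcs Q \<times> arcs K,
      tail = map_prod (tail Q) (tail K), head = map_prod (head Q) (head K)\<rparr>"

text \<open>The product of morphisms with domains \<open>Q\<close> and \<open>K\<close>.\<close>

definition quiver_prod_map ::
    "('v, 'e) pre_digraph \<Rightarrow> ('w, 'f) pre_digraph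
      \<Rightarrow> ('v, 'e, 'v1, 'e1) quiver_map \<Rightarrow> ('w, 'f, 'w1, 'f1) quiver_map
      \<Rightarrow> ('v \<times> 'w, 'e \<times> 'f, 'v1 \<times> 'w1, 'e1 \<times> 'f1) quiver_map" where
  "quiver_prod_map Q K \<phi> \<chi> =
     \<lparr>vmap = restrict (map_prod (vmap \<phi>) (vmap \<chi>)) (verts Q \<times> verts K),
      emap = restrict (map_prod (emap \<phi>) (emap \<chi>)) (arcs Q \<times> arcs K)\<rparr>"

record ('v, 'e, 'i) pre_inc_hypergraph =
  hverts :: "'v set"
  hedges :: "'e set"
  hincs :: "'i set"
  hport :: "'i \<Rightarrow> 'v"
  hatt :: "'i \<Rightarrow> 'e"

definition inc_hypergraph :: "('v, 'e, 'i) pre_inc_hypergraph \<Rightarrow> bool" where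
  "inc_hypergraph G \<longleftrightarrow> hport G \<in> hincs G \<rightarrow> hverts G \<and> hatt G \<in> hincs G \<rightarrow> hedges G"

record ('v, 'e, 'i, 'w, 'f, 'j) hyper_map =
  hvmap :: "'v \<Rightarrow> 'w"
  hemap :: "'e \<Rightarrow> 'f"
  himap :: "'i \<Rightarrow> 'j"

definition hyper_hom ::
    "('v, 'e, 'i) pre_inc_hypergraph \<Rightarrow> ('w, 'f, 'j) pre_inc_hypergraph
      \<Rightarrow> ('v, 'e, 'i, 'w, 'f, 'j) hyper_map set" where
  "hyper_hom G H = {\<phi>.
     hvmap \<phi> \<in> hverts G \<rightarrow>\<^sub>E hverts H \<and> hemap \<phi> \<in> hedges G \<rightarrow>\<^sub>E hedges H \<and>
     himap \<phi> \<in> hincs G \<rightarrow>\<^sub>E hincs H \<and>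
     (\<forall>i \<in> hincs G. hport H (himap \<phi> i) = hvmap \<phi> (hport G i)) \<and>
     (\<forall>i \<in> hincs G. hatt H (himap \<phi> i) = hemap \<phi> (hatt G i))}"

definition Upsilon :: "('v, 'e) pre_digraph \<Rightarrow> ('v, 'v, 'e) pre_inc_hypergraph" where
  "Upsilon Q =
     \<lparr>hverts = verts Q, hedges = verts Q, hincs = arcs Q, hport = tail Q, hatt = head Q\<rparr>"

text \<open>\<open>quiver_exp R Q\<close> is \<open>R\<close> to the power \<open>Q\<close>.\<close>

definition quiver_exp ::
    "('w, 'f) pre_digraph \<Rightarrow> ('v, 'e) pre_digraph
      \<Rightarrow> ('v \<Rightarrow> 'w, ('v, 'v, 'e, 'w, 'w, 'f) hyper_map) pre_digraph" where
  "quiver_exp R Q =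
     \<lparr>verts = verts Q \<rightarrow>\<^sub>E verts R, arcs = hyper_hom (Upsilon Q) (Upsilon R),
      tail = hvmap, head = hemap\<rparr>"

definition quiver_eval ::
    "('v, 'e) pre_digraph \<Rightarrow> ('w, 'f) pre_digraph
      \<Rightarrow> ('v \<times> ('v \<Rightarrow> 'w), 'e \<times> ('v, 'v, 'e, 'w, 'w, 'f) hyper_map, 'w, 'f) quiver_map" where
  "quiver_eval Q R =
     \<lparr>vmap = (\<lambda>(v, f) \<in> verts (quiver_prod Q (quiver_exp R Q)). f v),
      emap = (\<lambda>(e, \<phi>) \<in> arcs (quiver_prod Q (quiver_exp R Q)). himap \<phi> e)\<rparr>"

lemma wf_digraph_quiver_prod:
  assumes "wf_digraph Q" and "wf_digraph K"
  shows "wf_digraph (quiver_prod Q K)"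
  using assms by (auto simp: wf_digraph_def quiver_prod_def)

lemma inc_hypergraph_Upsilon:
  assumes "wf_digraph Q"
  shows "inc_hypergraph (Upsilon Q)"
  using assms by (auto simp: wf_digraph_def inc_hypergraph_def Upsilon_def)

lemma quiver_id_in_hom:
  assumes "wf_digraph Q"
  shows "quiver_id Q \<in> quiver_hom Q Q"
  using assms by (auto simp: wf_digraph_def quiver_hom_def quiver_id_def)

lemma quiver_comp_in_hom:
  assumes "wf_digraph P" and "\<psi> \<in> quiver_hom Q R" and "\<phi> \<in> quiver_hom P Q"
  shows "quiver_comp P \<psi> \<phi> \<in> quiver_hom P R"
  using assms
  by (auto simp: wf_digraph_def quiver_hom_def quiver_comp_def compose_def PiE_iff)

lemma quiver_prod_map_in_hom:
  assumes "wf_digraph Q" and "wf_digraph K"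
    and "\<phi> \<in> quiver_hom Q Q'" and "\<chi> \<in> quiver_hom K K'"
  shows "quiver_prod_map Q K \<phi> \<chi> \<in> quiver_hom (quiver_prod Q K) (quiver_prod Q' K')"
  using assms
  by (auto simp: wf_digraph_def quiver_hom_def quiver_prod_def quiver_prod_map_def PiE_iff)

end

theory Submission
  imports Defs
begin

text \<open>Since \<open>Upsilon\<close> uses the vertex set for both its vertices and its edges,
  \<open>hvmap\<close> and \<open>hemap\<close> of a morphism both lie in
  \<open>verts Q \<rightarrow>\<^sub>E verts R\<close>.\<close>

lemma wf_digraph_quiver_exp: "wf_digraph (quiver_exp R Q)"
  by (auto simp: wf_digraph_def quiver_exp_def hyper_hom_def Upsilon_def)

text \<open>The two incidence conditions on \<phi> in \<open>hyper_hom\<close>, taken at an arc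
  \<open>e\<close>, are the source and target conditions for evaluation at
  \<open>(e, \<phi>)\<close>.\<close>

lemma quiver_eval_in_hom:
  assumes "wf_digraph Q"
  shows "quiver_eval Q R \<in> quiver_hom (quiver_prod Q (quiver_exp R Q)) R"
  using assms
  by (auto simp: wf_digraph_def quiver_hom_def quiver_eval_def quiver_prod_def quiver_exp_def
      hyper_hom_def Upsilon_def PiE_iff)

text \<open>The source and target maps of the exponential force the choice of \<open>hvmap\<close>
  and \<open>hemap\<close>. The inner restrictions make each component extensional, as membership in
  the hom-sets demands.\<close>

definition quiver_curry ::
    "('v, 'e) pre_digraph \<Rightarrow> ('u, 'd) pre_digraph \<Rightarrow> ('v \<times> 'u, 'e \<times> 'd, 'w, 'f) quiver_map
      \<Rightarrow> ('u, 'd, 'v \<Rightarrow> 'w, ('v, 'v, 'e, 'w, 'w, 'f) hyper_map) quiver_map" where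
  "quiver_curry Q K \<psi> =
     \<lparr>vmap = (\<lambda>k \<in> verts K. \<lambda>v \<in> verts Q. vmap \<psi> (v, k)),
      emap = (\<lambda>d \<in> arcs K.
        \<lparr>hvmap = (\<lambda>v \<in> verts Q. vmap \<psi> (v, tail K d)),
         hemap = (\<lambda>v \<in> verts Q. vmap \<psi> (v, head K d)),
         himap = (\<lambda>e \<in> arcs Q. emap \<psi> (e, d))\<rparr>)\<rparr>"

text \<open>For a fixed arc \<open>d\<close>, the source and target conditions on \<psi> at the
  pairs \<open>(e, d)\<close> say that the triple over \<open>d\<close> is a morphism of incidence
  hypergraphs.\<close>

lemma quiver_curry_in_hom:
  assumes "wf_digraph Q" and "wf_digraph K" and "\<psi> \<in> quiver_hom (quiver_prod Q K) R"
  shows "quiver_curry Q K \<psi> \<in> quiver_hom K (quiver_exp R Q)"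
  using assms
  by (auto simp: wf_digraph_def quiver_hom_def quiver_curry_def quiver_prod_def quiver_exp_def
      hyper_hom_def Upsilon_def PiE_iff)

text \<open>A closed form for the composite with evaluation, so that existence and uniqueness become
  the two inverse laws with \<open>quiver_curry\<close>.\<close>

definition quiver_uncurry ::
    "('v, 'e) pre_digraph \<Rightarrow> ('u, 'd) pre_digraph
      \<Rightarrow> ('u, 'd, 'v \<Rightarrow> 'w, ('v, 'v, 'e, 'w, 'w, 'f) hyper_map) quiver_map
      \<Rightarrow> ('v \<times> 'u, 'e \<times> 'd, 'w, 'f) quiver_map" where
  "quiver_uncurry Q K \<chi> =
     \<lparr>vmap = (\<lambda>(v, k) \<in> verts Q \<times> verts K. vmap \<chi> k v),
      emap = (\<lambda>(e, d) \<in> arcs Q \<times> arcs K. himap (emap \<chi> d) e)\<rparr>"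

text \<open>As \<chi> takes values in the exponential, the product map stays inside the domain of
  \<open>quiver_eval\<close>, where evaluation is not \<open>undefined\<close>.\<close>

lemma quiver_comp_eval_prod_map:
  assumes "\<chi> \<in> quiver_hom K (quiver_exp R Q)"
  shows "quiver_comp (quiver_prod Q K) (quiver_eval Q R) (quiver_prod_map Q K (quiver_id Q) \<chi>)
    = quiver_uncurry Q K \<chi>"
  using assms
  by (auto simp: quiver_hom_def quiver_uncurry_def quiver_comp_def quiver_eval_def quiver_prod_def
      quiver_prod_map_def quiver_id_def compose_def fun_eq_iff PiE_iff)

lemma quiver_uncurry_curry:
  assumes "\<psi> \<in> quiver_hom (quiver_prod Q K) R"
  shows "quiver_uncurry Q K (quiver_curry Q K \<psi>) = \<psi>"
  using assms
  by (cases \<psi>) (auto simp: quiver_hom_def quiver_uncurry_def quiver_curry_def quiver_prod_def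
      fun_eq_iff PiE_iff extensional_def)

text \<open>The vertex and edge parts of \<open>emap \<chi> d\<close> are its source and target in the exponential, so
  \<open>vmap \<chi>\<close> determines them; only the incidence part needs the edge part of the uncurried map.\<close>

lemma quiver_curry_uncurry:
  assumes "wf_digraph K" and "\<chi> \<in> quiver_hom K (quiver_exp R Q)"
  shows "quiver_curry Q K (quiver_uncurry Q K \<chi>) = \<chi>"
proof (rule quiver_map.equality)
  have v: "vmap \<chi> \<in> verts K \<rightarrow>\<^sub>E (verts Q \<rightarrow>\<^sub>E verts R)"
    and e: "emap \<chi> \<in> arcs K \<rightarrow>\<^sub>E hyper_hom (Upsilon Q) (Upsilon R)"
    and t: "\<And>d. d \<in> arcs K \<Longrightarrow> hvmap (emap \<chi> d) = vmap \<chi> (tail K d)"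
    and h: "\<And>d. d \<in> arcs K \<Longrightarrow> hemap (emap \<chi> d) = vmap \<chi> (head K d)"
    using assms(2) by (auto simp: quiver_hom_def quiver_exp_def)
  have restrict_vmap: "(\<lambda>x \<in> verts Q. vmap \<chi> k x) = vmap \<chi> k" if "k \<in> verts K" for k
    using PiE_mem[OF v that] by (simp add: PiE_iff extensional_restrict)
  show "vmap (quiver_curry Q K (quiver_uncurry Q K \<chi>)) = vmap \<chi>"
  proof (rule extensionalityI[of _ "verts K"])
    show "vmap \<chi> \<in> extensional (verts K)"
      using v by (simp add: PiE_iff)
  \<comment> \<open>The congruence rule supplies \<open>v \<in> verts Q\<close> under the inner
    restriction, which is needed to evaluate the restricted function in
    \<open>quiver_uncurry\<close>.\<close>
  qed (simp_all add: quiver_curry_def quiver_uncurry_def restrict_vmap cong: restrict_cong)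
  show "emap (quiver_curry Q K (quiver_uncurry Q K \<chi>)) = emap \<chi>"
  proof (rule extensionalityI[of _ "arcs K"])
    show "emap \<chi> \<in> extensional (arcs K)"
      using e by (simp add: PiE_iff)
  next
    fix d assume d: "d \<in> arcs K"
    \<comment> \<open>Both ends of \<open>d\<close> must be vertices for
      \<open>restrict_vmap\<close> to apply to the components that \<open>t\<close> and
      \<open>h\<close> identify.\<close>
    then have "tail K d \<in> verts K" "head K d \<in> verts K"
      using assms(1) by (auto simp: wf_digraph_def)
    moreover have "(\<lambda>x \<in> arcs Q. himap (emap \<chi> d) x) = himap (emap \<chi> d)"
      using PiE_mem[OF e d] by (simp add: hyper_hom_def Upsilon_def PiE_iff extensional_restrict)
    ultimately show "emap (quiver_curry Q K (quiver_uncurry Q K \<chi>)) d = emap \<chi> d"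
      using d by (simp add: quiver_curry_def quiver_uncurry_def restrict_vmap t h
          cong: restrict_cong)
  qed (simp add: quiver_curry_def)
qed simp

theorem mainTheorem20:
  fixes Q :: "('v, 'e) pre_digraph" and R :: "('w, 'f) pre_digraph"
  assumes "wf_digraph Q" and "wf_digraph R"
  shows "wf_digraph (quiver_exp R Q) \<and>
    quiver_eval Q R \<in> quiver_hom (quiver_prod Q (quiver_exp R Q)) R \<and>
    (\<forall>K :: ('u, 'd) pre_digraph. wf_digraph K \<longrightarrow>
      (\<forall>\<psi> \<in> quiver_hom (quiver_prod Q K) R.
        \<exists>!\<psi>'. \<psi>' \<in> quiver_hom K (quiver_exp R Q) \<and>
          quiver_comp (quiver_prod Q K) (quiver_eval Q R) (quiver_prod_map Q K (quiver_id Q) \<psi>') = \<psi>))"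
proof (intro conjI allI impI ballI)
  fix K :: "('u, 'd) pre_digraph" and \<psi>
  assume K: "wf_digraph K" and \<psi>: "\<psi> \<in> quiver_hom (quiver_prod Q K) R"
  show "\<exists>!\<psi>'. \<psi>' \<in> quiver_hom K (quiver_exp R Q) \<and>
    quiver_comp (quiver_prod Q K) (quiver_eval Q R) (quiver_prod_map Q K (quiver_id Q) \<psi>') = \<psi>"
  proof (rule ex1I[of _ "quiver_curry Q K \<psi>"])
    show "quiver_curry Q K \<psi> \<in> quiver_hom K (quiver_exp R Q) \<and>
      quiver_comp (quiver_prod Q K) (quiver_eval Q R)
        (quiver_prod_map Q K (quiver_id Q) (quiver_curry Q K \<psi>)) = \<psi>"
      using quiver_curry_in_hom[OF assms(1) K \<psi>] quiver_uncurry_curry[OF \<psi>]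
      by (simp add: quiver_comp_eval_prod_map)
  next
    fix \<psi>'
    assume "\<psi>' \<in> quiver_hom K (quiver_exp R Q) \<and>
      quiver_comp (quiver_prod Q K) (quiver_eval Q R) (quiver_prod_map Q K (quiver_id Q) \<psi>') = \<psi>"
    then show "\<psi>' = quiver_curry Q K \<psi>"
      \<comment> \<open>The composite is the uncurried form of \<open>\<psi>'\<close>, so currying
        \<psi> gives \<open>\<psi>'\<close> back.\<close>
      using quiver_curry_uncurry[OF K] quiver_comp_eval_prod_map by metis
  qed
qed (simp_all add: assms wf_digraph_quiver_exp quiver_eval_in_hom)

end
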